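(* Let $\mathbb{K}$ be an algebraically closed field, let $V$ be an $n$-dimensional vector space over $\mathbb{K}$, and let $(L_1,\ldots,L_n)$ be an irreducible tuple of vector subspaces of $V$. Identify $V^{\times n}$ with the space of $n\times n$ square matrices over $\mathbb{K}$, and let $\mathrm{Det}\subset V^{\times n}$ be the determinant hypersurface. Then the intersection $\mathrm{Det}\cap(L_1\times\cdots\times L_n)$ is irreducible.
   Context: A tuple $(L_1,\ldots,L_n)$ of vector subspaces of an $n$-dimensional vector space $V$ is irreducible if, for every $k$ with $0<k<n$, no $k$ of the subspaces $L_1,\ldots,L_n$ lie in one common $k$-dimensional subspace of $V$. The space $V^{\times n}$ is identified with $n\times n$ matrices by choosing a basis of $V$ and regarding $(v_1,\ldots,v_n)\in V^{\times n}$ as the matrix with rows $v_1,\ldots,v_n$. The determinant hypersurface $\mathrm{Det}$ is the set of matrices with zero determinant. All spaces carry the Zariski topology, and irreducible means irreducible as an algebraic set. *)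

theory Defs
  imports "HOL-Analysis.Analysis" "HOL-Computational_Algebra.Computational_Algebra"
begin

subsection \<open>Tuples of subspaces and tuples of vectors\<close>

context vector_space
begin

text \<open>
  A tuple is a family over a finite index type, and the condition ranges over sets \<open>I\<close> of
  indices: equal members of the tuple at different indices count separately.
\<close>

definition irreducible_tuple :: "('n::finite \<Rightarrow> 'b set) \<Rightarrow> bool" where
  "irreducible_tuple L \<longleftrightarrow>
     (\<forall>i. subspace (L i)) \<and>
     (\<forall>k. 0 < k \<and> k < CARD('n) \<longrightarrow>
        \<not> (\<exists>I W. card I = k \<and> subspace W \<and> dim W = k \<and> (\<forall>i\<in>I. L i \<subseteq> W)))"

definition indexed_basis :: "('n::finite \<Rightarrow> 'b) \<Rightarrow> bool" where
  "indexed_basis b \<longleftrightarrow> inj b \<and> independent (range b) \<and> span (range b) = UNIV"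

text \<open>The \<open>i\<close>-th row consists of the coordinates of \<open>v i\<close> in the basis \<open>b\<close>.\<close>

definition row_matrix :: "('n::finite \<Rightarrow> 'b) \<Rightarrow> ('n \<Rightarrow> 'b) \<Rightarrow> 'a ^ 'n ^ 'n" where
  "row_matrix b v = (\<chi> i j. representation (range b) (v i) (b j))"

end

definition det_hypersurface :: "('k::comm_ring_1 ^ 'n::finite ^ 'n) set" where
  "det_hypersurface = {A. det A = 0}"

subsection \<open>The Zariski topology on the affine space of matrices\<close>

inductive matrix_polynomial_function :: "('k::comm_ring_1 ^ 'n::finite ^ 'm::finite \<Rightarrow> 'k) \<Rightarrow> bool" where
  const: "matrix_polynomial_function (\<lambda>A. c)"
| entry: "matrix_polynomial_function (\<lambda>A. A $ i $ j)"
| add: "matrix_polynomial_function f \<Longrightarrow> matrix_polynomial_function g \<Longrightarrow>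
        matrix_polynomial_function (\<lambda>A. f A + g A)"
| mult: "matrix_polynomial_function f \<Longrightarrow> matrix_polynomial_function g \<Longrightarrow>
        matrix_polynomial_function (\<lambda>A. f A * g A)"

definition algebraic_set :: "('k::comm_ring_1 ^ 'n::finite ^ 'm::finite) set \<Rightarrow> bool" where
  "algebraic_set S \<longleftrightarrow>
     (\<exists>P. (\<forall>f\<in>P. matrix_polynomial_function f) \<and> S = {A. \<forall>f\<in>P. f A = 0})"

text \<open>The empty set does not count as irreducible.\<close>

definition irreducible_algebraic_set :: "('k::comm_ring_1 ^ 'n::finite ^ 'm::finite) set \<Rightarrow> bool" where
  "irreducible_algebraic_set S \<longleftrightarrow>
     algebraic_set S \<and> S \<noteq> {} \<and>
     (\<forall>X Y. algebraic_set X \<and> algebraic_set Y \<and> S = X \<union> Y \<longrightarrow> S = X \<or> S = Y)"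

end

theory Submission
  imports Defs
begin

text \<open>
  A singular matrix \<open>A\<close> with rows in the \<open>M i\<close> has a kernel vector \<open>x \<noteq> 0\<close>. If no \<open>M i\<close> is
  orthogonal to \<open>x\<close>, then \<open>A\<close> lies in the image of the polynomial map
  \<open>(x, l, w) \<mapsto> ((x \<sqdot> l\<^sub>i) w\<^sub>i - (x \<sqdot> w\<^sub>i) l\<^sub>i)\<^sub>i\<close>, defined on an affine space and with singular values;
  any two points of the image are joined by a polynomial curve inside it, so its closure is
  irreducible. It remains to see that the image is dense. Let \<open>I\<close> be the set of those \<open>i\<close> with
  \<open>M i\<close> orthogonal to \<open>x\<close>. Irreducibility of the tuple prevents the \<open>|I|\<close> rows \<open>A\<^sub>i\<close>, \<open>i \<in> I\<close>,
  from spanning all \<open>M i\<close>, \<open>i \<in> I\<close>, so some \<open>y\<close> is orthogonal to these rows but not to all of these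
  \<open>M i\<close>. Moving the kernel vector along \<open>x + t y\<close>, and correcting the other rows accordingly, deforms \<open>A\<close>
  inside the singular matrices to ones with a strictly smaller \<open>I\<close>.
\<close>

no_notation fps_nth (infixl \<open>$\<close> 75)  \<comment> \<open>it would clash with \<open>vec_nth\<close>\<close>

text \<open>If the field were finite, adding 1 to the product of all \<open>X - a\<close> would give
  a polynomial of positive degree whose value is 1 everywhere.\<close>

lemma infinite_UNIV_alg_closed_field: "infinite (UNIV :: 'a::alg_closed_field set)"
proof
  assume fin: "finite (UNIV :: 'a set)"
  define p :: "'a poly" where "p = (\<Prod>a\<in>UNIV. [:- a, 1:])"
  have "degree p = CARD('a)"
    unfolding p_def by (subst degree_prod_eq_sum_degree) auto
  moreover have "CARD('a) > 0" using fin by (simp add: card_gt_0_iff)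
  ultimately have "degree (p + 1) > 0" by (simp add: degree_add_eq_left)
  then obtain z where z: "poly (p + 1) z = 0" using alg_closed_imp_poly_has_root by blast
  have "poly p z = 0" unfolding p_def using fin by (auto simp: poly_prod)
  with z show False by simp
qed

section \<open>The standard bilinear form on coordinate vectors\<close>

definition vec_dot :: "'k::comm_semiring_0 ^ 'n::finite \<Rightarrow> 'k ^ 'n \<Rightarrow> 'k" where
  "vec_dot x y = (\<Sum>j\<in>UNIV. x $ j * y $ j)"

lemma matrix_vector_mult_nth: "(A *v x) $ i = vec_dot (A $ i) x"
  by (simp add: matrix_vector_mult_def vec_dot_def)

lemma vec_dot_add_left: "vec_dot (x + y) z = vec_dot x z + vec_dot y z"
  by (simp add: vec_dot_def algebra_simps sum.distrib)

lemma vec_dot_add_right: "vec_dot z (x + y) = vec_dot z x + vec_dot z y"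
  by (simp add: vec_dot_def algebra_simps sum.distrib)

lemma vec_dot_diff_left:
  fixes x :: "'k::comm_ring ^ 'n"
  shows "vec_dot (x - y) z = vec_dot x z - vec_dot y z"
  by (simp add: vec_dot_def algebra_simps sum_subtractf)

lemma vec_dot_scale_left: "vec_dot (c *s x) z = c * vec_dot x z"
  by (simp add: vec_dot_def sum_distrib_left ac_simps)

lemma vec_dot_scale_right: "vec_dot z (c *s x) = c * vec_dot z x"
  by (simp add: vec_dot_def sum_distrib_left ac_simps)

lemmas vec_dot_simps =
  vec_dot_add_left vec_dot_add_right vec_dot_diff_left vec_dot_scale_left vec_dot_scale_right

lemma vec_dot_0_left [simp]: "vec_dot 0 x = 0"
  and vec_dot_0_right [simp]: "vec_dot x 0 = 0"
  by (simp_all add: vec_dot_def)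

lemma vec_dot_axis:
  fixes x :: "'k::comm_semiring_1 ^ 'n"
  shows "vec_dot (axis k 1) x = x $ k"
  by (simp add: vec_dot_def axis_def if_distrib[where f = "\<lambda>c. c * _"] cong: if_cong)

text \<open>A linear map that fixes \<open>x\<close> and kills a basis of the span of
  \<open>W\<close> exists; a row of its matrix is the wanted \<open>y\<close>. This supplies both
  linear equations for subspaces and directions in which to move a kernel vector.\<close>

lemma vec_separation:
  fixes x :: "'k::field ^ 'n"
  assumes "x \<notin> vec.span W"
  obtains y where "\<And>w. w \<in> W \<Longrightarrow> vec_dot w y = 0" and "vec_dot x y \<noteq> 0"
proof -
  obtain B where B: "B \<subseteq> W" "vec.independent B" "W \<subseteq> vec.span B"
    using vec.maximal_independent_subset by metis
  have xB: "x \<notin> vec.span B" using assms B(1) vec.span_mono by blast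
  then have ind: "vec.independent (insert x B)" using B(2) by (simp add: vec.independent_insert)
  obtain g :: "'k ^ 'n \<Rightarrow> 'k ^ 'n" where lin: "Vector_Spaces.linear (*s) (*s) g"
    and g: "\<forall>v\<in>insert x B. g v = (if v = x then x else 0)"
    using vec.linear_independent_extend[OF ind, of "\<lambda>v. if v = x then x else 0"] by auto
  have gB: "g v = 0" if "v \<in> B" for v
    using g that xB vec.span_base by auto
  have gW: "g w = 0" if "w \<in> W" for w
    using vec.linear_eq_0_on_span[OF lin gB] that B(3) by blast
  have "x \<noteq> 0" using assms vec.span_zero by metis
  then obtain k where k: "x $ k \<noteq> 0" by (auto simp: vec_eq_iff)
  \<comment> \<open>Pairing with row \<open>k\<close> of the matrix reads off coordinate
    \<open>k\<close> of \<open>g v\<close>, and \<open>k\<close> was chosen so that this is nonzero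
    for \<open>g x = x\<close>.\<close>
  have dot: "vec_dot v (matrix g $ k) = g v $ k" for v
    using matrix_works[OF lin, of v] matrix_vector_mult_nth[of "matrix g" v k]
    by (simp add: vec_dot_def mult.commute)
  show thesis
    using that[of "matrix g $ k"] dot gW g k by simp
qed

section \<open>Irreducible tuples of subspaces\<close>

text \<open>The definition of irreducibility speaks of subspaces of dimension exactly
  \<open>k\<close>, while applications only bound the dimension from above. A basis of the smaller
  span is therefore enlarged, within a basis of the whole space, to exactly \<open>card I\<close>
  vectors.\<close>

lemma (in finite_dimensional_vector_space) irreducible_tuple_not_subset:
  fixes L :: "'n::finite \<Rightarrow> 'b set"
  assumes "irreducible_tuple L" and card: "CARD('n) \<le> dimension"
    and I: "I \<noteq> {}" "I \<noteq> UNIV" and W: "dim W \<le> card I"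
  shows "\<exists>i\<in>I. \<not> L i \<subseteq> span W"
proof (rule ccontr)
  assume contra: "\<not> ?thesis"
  have cI: "0 < card I" "card I < CARD('n)"
    using I by (auto simp: card_gt_0_iff intro!: psubset_card_mono)
  obtain B where B: "B \<subseteq> span W" "independent B" "span B = span W" "card B = dim (span W)"
    using basis_subspace_exists[OF subspace_span] by metis
  have eb: "B \<subseteq> extend_basis B" "independent (extend_basis B)" "span (extend_basis B) = UNIV"
    using B(2) by (simp_all add: extend_basis_superset independent_extend_basis)
  have "card (extend_basis B) = dimension"
    using eb(2,3) by (metis dim_UNIV dim_eq_card_independent dim_span dimension_def)
  then have "card B \<le> card I" "card I \<le> card (extend_basis B)"
    using B(4) W cI card by auto
  then obtain C where C: "B \<subseteq> C" "C \<subseteq> extend_basis B" "card C = card I"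
    using exists_subset_between[of B "card I" "extend_basis B"] eb finiteI_independent by metis
  have "independent C" using C(2) eb(2) independent_mono by blast
  then have "dim (span C) = card I" using C(3) by (simp add: dim_eq_card_independent)
  moreover have "\<forall>i\<in>I. L i \<subseteq> span C"
    using contra B(3) span_mono[OF C(1)] by blast
  ultimately show False
    using assms(1) cI subspace_span unfolding irreducible_tuple_def by blast
qed

text \<open>A subspace violating irreducibility of the images pulls back along the bijection to one
  of the same dimension violating it for \<open>L\<close>.\<close>

lemma irreducible_tuple_linear_image:
  fixes f :: "'v::ab_group_add \<Rightarrow> 'w::ab_group_add" and L :: "'n::finite \<Rightarrow> 'v set"
  assumes lin: "Vector_Spaces.linear s1 s2 f" and "bij f"
    and irr: "vector_space.irreducible_tuple s1 L"
  shows "vector_space.irreducible_tuple s2 (\<lambda>i. f ` L i)"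
proof -
  interpret f: Vector_Spaces.linear s1 s2 f by fact
  have inj: "inj f" and surj: "surj f" using \<open>bij f\<close> by (auto simp: bij_def)
  have "\<not> (\<exists>I W. card I = k \<and> f.vs2.subspace W \<and> f.vs2.dim W = k \<and> (\<forall>i\<in>I. f ` L i \<subseteq> W))"
    if k: "0 < k \<and> k < CARD('n)" for k
  proof
    assume "\<exists>I W. card I = k \<and> f.vs2.subspace W \<and> f.vs2.dim W = k \<and> (\<forall>i\<in>I. f ` L i \<subseteq> W)"
    then obtain I W where I: "card I = k"
      and W: "f.vs2.subspace W" "f.vs2.dim W = k" "\<forall>i\<in>I. f ` L i \<subseteq> W" by blast
    have sub: "f.vs1.subspace (f -` W)" by (rule f.subspace_vimage[OF W(1)])
    obtain B where B: "B \<subseteq> f -` W" "f.vs1.independent B" "f -` W \<subseteq> f.vs1.span B"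
        "card B = f.vs1.dim (f -` W)"
      using f.vs1.basis_exists by metis
    have "f.vs2.independent (f ` B)"
      using f.independent_inj_on_image[OF B(2)] inj by (meson inj_on_subset subset_UNIV)
    moreover have "f.vs2.span (f ` B) = f.vs2.span W"
      using f.span_image[of B] f.vs1.span_subspace[OF B(1,3) sub] surj
        f.vs2.span_eq_iff[of W, THEN iffD2, OF W(1)]
      by (simp only: surj_image_vimage_eq)
    ultimately have "f.vs2.dim W = card (f ` B)" by (intro f.vs2.dim_eq_card)
    then have "f.vs1.dim (f -` W) = k"
      using B(4) W(2) card_image[of f B] inj by (simp add: inj_on_subset)
    moreover have "\<forall>i\<in>I. L i \<subseteq> f -` W" using W(3) by auto
    ultimately have "card I = k \<and> f.vs1.subspace (f -` W) \<and> f.vs1.dim (f -` W) = k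
        \<and> (\<forall>i\<in>I. L i \<subseteq> f -` W)"
      using sub I W(2) by simp
    moreover have "\<not> (\<exists>I W. card I = k \<and> f.vs1.subspace W \<and> f.vs1.dim W = k \<and> (\<forall>i\<in>I. L i \<subseteq> W))"
      using irr k unfolding f.vs1.irreducible_tuple_def by simp
    ultimately show False by blast
  qed
  moreover have "f.vs2.subspace (f ` L i)" for i
    using irr by (intro f.subspace_image) (simp add: f.vs1.irreducible_tuple_def)
  ultimately show ?thesis unfolding f.vs2.irreducible_tuple_def
    by (intro conjI allI impI)
qed

section \<open>Polynomial functions and polynomial curves\<close>

lemma matrix_polynomial_function_sum:
  "(\<And>i. i \<in> S \<Longrightarrow> matrix_polynomial_function (f i)) \<Longrightarrow>
    matrix_polynomial_function (\<lambda>A. \<Sum>i\<in>S. f i A)"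
  by (induction S rule: infinite_finite_induct)
    (simp_all add: matrix_polynomial_function.const matrix_polynomial_function.add)

lemma matrix_polynomial_function_prod:
  "(\<And>i. i \<in> S \<Longrightarrow> matrix_polynomial_function (f i)) \<Longrightarrow>
    matrix_polynomial_function (\<lambda>A. \<Prod>i\<in>S. f i A)"
  by (induction S rule: infinite_finite_induct)
    (simp_all add: matrix_polynomial_function.const matrix_polynomial_function.mult)

lemma matrix_polynomial_function_det: "matrix_polynomial_function det"
  unfolding det_def[abs_def]
  by (intro matrix_polynomial_function_sum matrix_polynomial_function_prod
      matrix_polynomial_function.intros)

lemma matrix_polynomial_function_vec_dot_row:
  "matrix_polynomial_function (\<lambda>A. vec_dot (A $ i) y)"
  unfolding vec_dot_def
  by (intro matrix_polynomial_function_sum matrix_polynomial_function.intros)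

definition polynomial_curve :: "('k::comm_ring_1 \<Rightarrow> 'k ^ 'n::finite ^ 'm::finite) \<Rightarrow> bool" where
  "polynomial_curve \<gamma> \<longleftrightarrow> (\<forall>i j. \<exists>p. \<forall>t. \<gamma> t $ i $ j = poly p t)"

lemma matrix_polynomial_function_curve:
  assumes "matrix_polynomial_function f" and "polynomial_curve \<gamma>"
  shows "\<exists>p. \<forall>t. f (\<gamma> t) = poly p t"
  using assms(1)
proof induction
  case (const c)
  then show ?case by (intro exI[of _ "[:c:]"]) simp
next
  case (entry i j)
  then show ?case using assms(2) by (simp add: polynomial_curve_def)
next
  case (add f g)
  then show ?case by (metis poly_add)
next
  case (mult f g)
  then show ?case by (metis poly_mult)
qed

text \<open>Along the curve \<open>f\<close> becomes a polynomial in one variable with infinitely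
  many roots. This substitutes for taking limits: exceptional parameters in \<open>F\<close> are
  recovered.\<close>

lemma polynomial_curve_vanishing:
  fixes \<gamma> :: "'k::field \<Rightarrow> 'k ^ 'n::finite ^ 'm::finite"
  assumes "infinite (UNIV :: 'k set)" and "matrix_polynomial_function f" and "polynomial_curve \<gamma>"
    and "finite F" and "\<And>t. t \<notin> F \<Longrightarrow> f (\<gamma> t) = 0"
  shows "f (\<gamma> s) = 0"
proof -
  obtain p where p: "\<And>t. f (\<gamma> t) = poly p t"
    using matrix_polynomial_function_curve[OF assms(2,3)] by blast
  have "UNIV - F \<subseteq> {t. poly p t = 0}" using assms(5) p by auto
  then have "infinite {t. poly p t = 0}"
    using assms(1,4) by (meson Diff_infinite_finite finite_subset)
  then have "p = 0" using poly_roots_finite by blast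
  then show ?thesis using p by simp
qed

text \<open>The condition \<open>prime\<close> says that the vanishing ideal of \<open>S\<close> is
  prime. For a proper decomposition, an equation of \<open>X\<close> and one of \<open>Y\<close>,
  each failing somewhere on \<open>S\<close>, would have a product vanishing on
  \<open>S\<close>.\<close>

lemma irreducible_algebraic_setI:
  assumes "algebraic_set S" "S \<noteq> {}"
    and prime: "\<And>f g. matrix_polynomial_function f \<Longrightarrow> matrix_polynomial_function g \<Longrightarrow>
      (\<And>A. A \<in> S \<Longrightarrow> f A * g A = 0) \<Longrightarrow> (\<forall>A\<in>S. f A = 0) \<or> (\<forall>A\<in>S. g A = 0)"
  shows "irreducible_algebraic_set S"
  unfolding irreducible_algebraic_set_def
proof (intro conjI assms(1,2) allI impI)
  fix X Y assume XY: "algebraic_set X \<and> algebraic_set Y \<and> S = X \<union> Y"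
  then obtain P Q where P: "\<forall>f\<in>P. matrix_polynomial_function f" "X = {A. \<forall>f\<in>P. f A = 0}"
    and Q: "\<forall>f\<in>Q. matrix_polynomial_function f" "Y = {A. \<forall>f\<in>Q. f A = 0}"
    unfolding algebraic_set_def by auto
  show "S = X \<or> S = Y"
  proof (rule ccontr)
    assume "\<not> (S = X \<or> S = Y)"
    then obtain A B where "A \<in> S" "A \<notin> X" "B \<in> S" "B \<notin> Y" using XY by blast
    then obtain f g where fg: "f \<in> P" "f A \<noteq> 0" "g \<in> Q" "g B \<noteq> 0" using P(2) Q(2) by auto
    have "f C * g C = 0" if "C \<in> S" for C
      using that XY P(2) Q(2) fg by auto
    then have "(\<forall>A\<in>S. f A = 0) \<or> (\<forall>A\<in>S. g A = 0)"
      by (rule prime[rotated 2]) (use P(1) Q(1) fg in auto)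
    then show False using fg \<open>A \<in> S\<close> \<open>B \<in> S\<close> by auto
  qed
qed

section \<open>Singular matrices with rows in given subspaces\<close>

lemma det_eq_0_iff_kernel:
  fixes A :: "'k::field ^ 'n ^ 'n"
  shows "det A = 0 \<longleftrightarrow> (\<exists>x. x \<noteq> 0 \<and> (\<forall>i. vec_dot (A $ i) x = 0))"
proof -
  have "det A = 0 \<longleftrightarrow> \<not> (\<forall>x. A *v x = 0 \<longrightarrow> x = 0)"
    using invertible_det_nz[of A] invertible_left_inverse[of A] matrix_left_invertible_ker[of A]
    by blast
  then show ?thesis by (auto simp: vec_eq_iff matrix_vector_mult_nth)
qed

lemma det_row_space_algebraic:
  fixes M :: "'n::finite \<Rightarrow> ('k::field ^ 'n) set"
  assumes "\<And>i. vec.subspace (M i)"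
  shows "algebraic_set (det_hypersurface \<inter> {A. \<forall>i. A $ i \<in> M i})"
proof -
  \<comment> \<open>Besides the determinant, \<open>P\<close> contains for each row all linear forms
    vanishing on \<open>M i\<close>; by \<open>vec_separation\<close> these cut out
    \<open>M i\<close>.\<close>
  define P where "P = insert det {\<lambda>A. vec_dot (A $ i) y | i y. \<forall>m\<in>M i. vec_dot m y = 0}"
  have "A $ i \<in> M i" if "\<forall>f\<in>P. f A = 0" for A i
  proof (rule ccontr)
    assume "A $ i \<notin> M i"
    then have "A $ i \<notin> vec.span (M i)" using assms[of i] vec.span_eq_iff by metis
    then obtain y where "\<And>m. m \<in> M i \<Longrightarrow> vec_dot m y = 0" "vec_dot (A $ i) y \<noteq> 0"
      using vec_separation by metis
    then have "(\<lambda>A. vec_dot (A $ i) y) \<in> P" by (auto simp: P_def)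
    from bspec[OF that this] show False using \<open>vec_dot (A $ i) y \<noteq> 0\<close> by simp
  qed
  then have "det_hypersurface \<inter> {A. \<forall>i. A $ i \<in> M i} = {A. \<forall>f\<in>P. f A = 0}"
    by (auto simp: det_hypersurface_def P_def)
  moreover have "\<forall>f\<in>P. matrix_polynomial_function f"
    by (auto simp: P_def matrix_polynomial_function_det matrix_polynomial_function_vec_dot_row)
  ultimately show ?thesis unfolding algebraic_set_def by blast
qed

section \<open>The parametrization by kernel vectors\<close>

text \<open>When \<open>vec_dot (l $ i) x = 1\<close>, row \<open>i\<close> is the projection of
  \<open>w $ i\<close> along \<open>l $ i\<close> onto the hyperplane orthogonal to
  \<open>x\<close>. The scaling avoids division, so the map is polynomial in all parameters.\<close>

definition kernel_param :: "'k::comm_ring_1 ^ 'n \<Rightarrow> 'k ^ 'n ^ 'n \<Rightarrow> 'k ^ 'n ^ 'n \<Rightarrow> 'k ^ 'n ^ 'n" where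
  "kernel_param x l w = (\<chi> i. vec_dot (l $ i) x *s w $ i - vec_dot (w $ i) x *s l $ i)"

lemma vec_dot_kernel_param: "vec_dot (kernel_param x l w $ i) x = 0"
  by (simp add: kernel_param_def vec_dot_simps)

lemma kernel_param_in:
  fixes x :: "'k::field ^ 'n" and l w :: "'k ^ 'n ^ 'n"
  assumes M: "\<And>i. vec.subspace (M i)" and "\<And>i. l $ i \<in> M i" "\<And>i. w $ i \<in> M i"
  shows "kernel_param x l w \<in> det_hypersurface \<inter> {A. \<forall>i. A $ i \<in> M i}"
proof -
  have "kernel_param x l w $ i \<in> M i" for i
    using assms by (simp add: kernel_param_def vec.subspace_diff vec.subspace_scale)
  moreover have "det (kernel_param x l w) = 0"
  proof (cases "x = 0")
    case True
    \<comment> \<open>For \<open>x = 0\<close> the matrix is zero, and the all-ones vector serves as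
      a nonzero kernel vector.\<close>
    have "vec_dot (kernel_param x l w $ i) 1 = 0" for i
      by (simp add: True kernel_param_def)
    moreover have "(1 :: 'k ^ 'n) \<noteq> 0" by (simp add: vec_eq_iff)
    ultimately show ?thesis unfolding det_eq_0_iff_kernel by blast
  next
    case False
    then show ?thesis unfolding det_eq_0_iff_kernel using vec_dot_kernel_param by blast
  qed
  ultimately show ?thesis by (auto simp: det_hypersurface_def)
qed

lemma polynomial_curve_kernel_param:
  fixes x x' :: "'k::field ^ 'n"
  shows "polynomial_curve (\<lambda>t. kernel_param (x + t *s x') (l + (\<chi> i. t *s l' $ i)) (w + (\<chi> i. t *s w' $ i)))"
  unfolding polynomial_curve_def
proof (intro allI)
  fix i j
  have lin: "\<exists>p. \<forall>t. a + t * b = poly p t" for a b :: 'k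
    by (intro exI[of _ "[:a, b:]"]) (simp add: mult.commute)
  have quad: "\<exists>p. \<forall>t. vec_dot (u + t *s u') (x + t *s x') = poly p t" for u u'
    by (intro exI[of _ "[:vec_dot u x, vec_dot u x' + vec_dot u' x, vec_dot u' x':]"])
      (simp add: vec_dot_simps algebra_simps)
  obtain p q r s where eqs:
    "\<And>t. vec_dot (l $ i + t *s l' $ i) (x + t *s x') = poly p t"
    "\<And>t. vec_dot (w $ i + t *s w' $ i) (x + t *s x') = poly q t"
    "\<And>t. w $ i $ j + t * w' $ i $ j = poly r t"
    "\<And>t. l $ i $ j + t * l' $ i $ j = poly s t"
    using quad lin by metis
  then show "\<exists>p. \<forall>t. kernel_param (x + t *s x') (l + (\<chi> i. t *s l' $ i))
      (w + (\<chi> i. t *s w' $ i)) $ i $ j = poly p t"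
    by (intro exI[of _ "p * r - q * s"]) (simp add: kernel_param_def eqs(1,2) algebra_simps flip: eqs(3,4))
qed

text \<open>The segment between two parameter points maps to a polynomial curve. As \<open>f\<close>
  is nonzero at its start, \<open>f\<close> has finitely many zeros along it, so \<open>g\<close>
  vanishes at all other parameters and hence on the whole curve.\<close>

lemma kernel_param_prime:
  fixes M :: "'n::finite \<Rightarrow> ('k::field ^ 'n) set" and l w l' w' :: "'k ^ 'n ^ 'n"
  assumes inf: "infinite (UNIV :: 'k set)"
    and M: "\<And>i. vec.subspace (M i)"
    and f: "matrix_polynomial_function f" and g: "matrix_polynomial_function g"
    and fg: "\<And>x l w. (\<And>i. l $ i \<in> M i) \<Longrightarrow> (\<And>i. w $ i \<in> M i) \<Longrightarrow>
      f (kernel_param x l w) * g (kernel_param x l w) = 0"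
    and lw: "\<And>i. l $ i \<in> M i" "\<And>i. w $ i \<in> M i" and nz: "f (kernel_param x l w) \<noteq> 0"
    and lw': "\<And>i. l' $ i \<in> M i" "\<And>i. w' $ i \<in> M i"
  shows "g (kernel_param x' l' w') = 0"
proof -
  define \<gamma> where "\<gamma> t = kernel_param (x + t *s (x' - x)) (l + (\<chi> i. t *s (l' - l) $ i))
      (w + (\<chi> i. t *s (w' - w) $ i))" for t
  have curve: "polynomial_curve \<gamma>"
    unfolding \<gamma>_def by (rule polynomial_curve_kernel_param)
  obtain p where p: "\<And>t. f (\<gamma> t) = poly p t"
    using matrix_polynomial_function_curve[OF f curve] by blast
  have fg0: "f (\<gamma> t) * g (\<gamma> t) = 0" for t
    unfolding \<gamma>_def using lw lw' M
    by (intro fg) (auto intro!: vec.subspace_add vec.subspace_scale vec.subspace_diff)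
  have \<gamma>0: "\<gamma> 0 = kernel_param x l w" by (simp add: \<gamma>_def vec_eq_iff kernel_param_def)
  have \<gamma>1: "\<gamma> 1 = kernel_param x' l' w'" by (simp add: \<gamma>_def vec_eq_iff kernel_param_def)
  have "p \<noteq> 0" using nz p[of 0] \<gamma>0 by auto
  then have fin: "finite {t. poly p t = 0}" by (rule poly_roots_finite)
  have "g (\<gamma> 1) = 0"
    by (rule polynomial_curve_vanishing[OF inf g curve fin]) (use fg0 p in auto)
  then show ?thesis using \<gamma>1 by simp
qed

lemma finite_affine_zero: "finite {t :: 'k::field. 1 + t * a = 0}"
proof -
  have "{t. 1 + t * a = 0} = {t. poly [:1, a:] t = 0}" by (simp add: mult.commute)
  then show ?thesis by (simp only:) (rule poly_roots_finite, simp)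
qed

section \<open>Density of the parametrized matrices\<close>

text \<open>Density is expressed through polynomial functions: whatever vanishes on the image of
  \<open>kernel_param\<close> vanishes at every singular \<open>A\<close> with rows in the
  \<open>M i\<close>. The induction is on the number of \<open>M i\<close> orthogonal to the kernel
  vector.\<close>

lemma kernel_param_dense:
  fixes M :: "'n::finite \<Rightarrow> ('k::field ^ 'n) set"
  assumes inf: "infinite (UNIV :: 'k set)"
    and irr: "vec.irreducible_tuple M"
    and f: "matrix_polynomial_function f"
    and vanish: "\<And>x l w. (\<And>i. l $ i \<in> M i) \<Longrightarrow> (\<And>i. w $ i \<in> M i) \<Longrightarrow> f (kernel_param x l w) = 0"
  shows "x \<noteq> 0 \<Longrightarrow> (\<And>i. A $ i \<in> M i) \<Longrightarrow> (\<And>i. vec_dot (A $ i) x = 0) \<Longrightarrow> f A = 0"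
proof (induction "card {i. \<forall>m\<in>M i. vec_dot m x = 0}" arbitrary: x A rule: less_induct)
  case less
  have M: "vec.subspace (M i)" for i using irr unfolding vec.irreducible_tuple_def by blast
  have dimn: "vec.dimension TYPE('k) TYPE('n) = CARD('n)"
    unfolding vec.dimension_def by (rule card_cart_basis)
  note not_subset = vec.irreducible_tuple_not_subset[OF irr, unfolded dimn, OF order_refl]
  define I where "I = {i. \<forall>m\<in>M i. vec_dot m x = 0}"
  have "\<exists>m. m \<in> M i \<and> vec_dot m x = 1" if not_I: "i \<notin> I" for i
  proof -
    obtain m where "m \<in> M i" "vec_dot m x \<noteq> 0" using not_I unfolding I_def by auto
    then show ?thesis using M[of i]
      by (intro exI[of _ "inverse (vec_dot m x) *s m"]) (simp add: vec.subspace_scale vec_dot_scale_left)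
  qed
  then obtain l where l: "\<And>i. i \<notin> I \<Longrightarrow> l i \<in> M i" "\<And>i. i \<notin> I \<Longrightarrow> vec_dot (l i) x = 1" by metis
  consider "I = {}" | "I = UNIV" | "I \<noteq> {}" "I \<noteq> UNIV" by blast
  then show ?case
  proof cases
    case 1
    \<comment> \<open>Rows of \<open>A\<close> already lie in the hyperplane orthogonal to
      \<open>x\<close>, so projecting onto it changes nothing.\<close>
    have "kernel_param x (\<chi> i. l i) A = A"
      by (simp add: kernel_param_def vec_eq_iff l 1 less.prems)
    then show ?thesis using vanish[of "\<chi> i. l i" A x] l 1 less.prems by simp
  next
    case 2  \<comment> \<open>all rows lie in a hyperplane, which irreducibility only permits for \<open>n = 1\<close>\<close>
    define H where "H = {m. vec_dot m x = 0}"
    have H: "vec.subspace H" by (auto simp: H_def vec.subspace_def vec_dot_simps)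
    obtain k where k: "x $ k \<noteq> 0" using less.prems(1) by (auto simp: vec_eq_iff)
    have "axis k 1 \<notin> H" using k by (simp add: H_def vec_dot_axis)
    then have "H \<noteq> UNIV" by blast
    moreover have "vec.span H = H" using H by (simp only: vec.span_eq_iff)
    ultimately have "vec.span H \<subset> vec.span UNIV" by (simp add: psubset_eq del: vec.span_eq_iff)
    from vec.dim_psubset[OF this] have "vec.dim H \<le> card (UNIV - {k})"
      by (simp add: card_Diff_singleton card_cart_basis)
    moreover have "M i \<subseteq> vec.span H" for i
    proof -
      have "i \<in> I" using 2 by simp
      then have "M i \<subseteq> H" by (auto simp: I_def H_def)
      then show ?thesis using vec.span_superset[of H] by (rule order_trans)
    qed
    \<comment> \<open>\<open>UNIV - {k}\<close> is just a set of \<open>n - 1\<close> indices,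
      enough to contradict irreducibility when nonempty, since \<open>H\<close> has dimension at
      most \<open>n - 1\<close>.\<close>
    ultimately have "UNIV - {k} = {}" using not_subset[of "UNIV - {k}" H] by auto
    then have univ: "UNIV = {k}" by blast
    have "A $ i $ j = 0" for i j
      using less.prems(3)[of i] k UNIV_I[of j] unfolding vec_dot_def univ by simp
    then have "A = kernel_param 0 0 0" by (simp add: vec_eq_iff kernel_param_def)
    then show ?thesis using vanish[of 0 0 0] M by (simp add: vec.subspace_0)
  next
    case 3
    define W where "W = (\<lambda>i. A $ i) ` I"
    have "vec.dim W \<le> card I"
      using vec.dim_le_card'[of W] card_image_le[of I "\<lambda>i. A $ i"] by (simp add: W_def)
    then obtain i0 m0 where i0: "i0 \<in> I" "m0 \<in> M i0" "m0 \<notin> vec.span W"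
      using not_subset[OF 3] by blast
    obtain y where y: "\<And>w. w \<in> W \<Longrightarrow> vec_dot w y = 0" "vec_dot m0 y \<noteq> 0"
      using vec_separation[OF i0(3)] by blast
    have yI: "vec_dot (A $ i) y = 0" if "i \<in> I" for i using y(1) that by (simp add: W_def)
    \<comment> \<open>Rows in \<open>I\<close> are orthogonal to both \<open>x\<close> and
      \<open>y\<close> and can stay. The others are the rows of \<open>kernel_param\<close> at
      \<open>x + t *s y\<close>, simplified by \<open>vec_dot (A $ i) x = 0\<close>.\<close>
    define \<gamma> where "\<gamma> t = (\<chi> i. if i \<in> I then A $ i else
        vec_dot (l i) (x + t *s y) *s A $ i - (t * vec_dot (A $ i) y) *s l i)" for t
    have curve: "polynomial_curve \<gamma>"
      unfolding polynomial_curve_def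
    proof (intro allI)
      fix i j
      show "\<exists>p. \<forall>t. \<gamma> t $ i $ j = poly p t"
      proof (cases "i \<in> I")
        case True
        then show ?thesis by (intro exI[of _ "[:A $ i $ j:]"]) (simp add: \<gamma>_def)
      next
        case False
        then show ?thesis
          by (intro exI[of _ "[:A $ i $ j, vec_dot (l i) y * A $ i $ j - vec_dot (A $ i) y * l i $ j:]"])
            (simp add: \<gamma>_def vec_dot_simps l algebra_simps)
      qed
    qed
    \<comment> \<open>Excluded are \<open>t = 0\<close> and the parameters at which some
      \<open>l i\<close> becomes orthogonal to \<open>x + t *s y\<close>; outside \<open>F\<close>
      no new index can join \<open>I\<close>.\<close>
    define F where "F = insert 0 (\<Union>i\<in>-I. {t. 1 + t * vec_dot (l i) y = 0})"
    have F: "finite F" by (simp add: F_def finite_affine_zero)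
    have "f (\<gamma> t) = 0" if t: "t \<notin> F" for t
    proof (rule less.hyps)
      \<comment> \<open>Since \<open>m0\<close> is orthogonal to \<open>x\<close>, the value is
        \<open>t * vec_dot m0 y\<close>. It shows at once that the new kernel vector is nonzero and
        that \<open>i0\<close> leaves the index set.\<close>
      have m0: "vec_dot m0 (x + t *s y) \<noteq> 0"
        using i0 y(2) t by (simp add: F_def vec_dot_simps I_def)
      then show "x + t *s y \<noteq> 0" by auto
      have "vec_dot (l i) (x + t *s y) \<noteq> 0" if "i \<notin> I" for i
        using t that l(2) by (auto simp: F_def vec_dot_simps)
      then have "{i. \<forall>m\<in>M i. vec_dot m (x + t *s y) = 0} \<subseteq> I" using l(1) by auto
      moreover have "i0 \<notin> {i. \<forall>m\<in>M i. vec_dot m (x + t *s y) = 0}" using i0(2) m0 by auto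
      ultimately have "{i. \<forall>m\<in>M i. vec_dot m (x + t *s y) = 0} \<subset> I" using i0(1) by blast
      then show "card {i. \<forall>m\<in>M i. vec_dot m (x + t *s y) = 0} < card {i. \<forall>m\<in>M i. vec_dot m x = 0}"
        unfolding I_def[symmetric] by (intro psubset_card_mono) auto
      show "\<gamma> t $ i \<in> M i" for i
        using M[of i] l(1)[of i] less.prems(2)[of i]
        by (simp add: \<gamma>_def vec.subspace_diff vec.subspace_scale)
      show "vec_dot (\<gamma> t $ i) (x + t *s y) = 0" for i
        using yI[of i] less.prems(3)[of i] by (simp add: \<gamma>_def vec_dot_simps algebra_simps)
    qed
    \<comment> \<open>The parameter 0 belongs to \<open>F\<close>, so the induction hypothesis does
      not cover \<open>A\<close> itself; vanishing extends to it along the curve.\<close>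
    from polynomial_curve_vanishing[OF inf f curve F this] have "f (\<gamma> 0) = 0" by blast
    moreover have "\<gamma> 0 = A" by (simp add: \<gamma>_def vec_eq_iff l)
    ultimately show ?thesis by simp
  qed
qed

text \<open>By density it suffices to test vanishing on the image of \<open>kernel_param\<close>,
  where primality follows by joining points with curves.\<close>

lemma det_row_space_irreducible:
  fixes M :: "'n::finite \<Rightarrow> ('k::field ^ 'n) set"
  assumes inf: "infinite (UNIV :: 'k set)" and irr: "vec.irreducible_tuple M"
  shows "irreducible_algebraic_set (det_hypersurface \<inter> {A. \<forall>i. A $ i \<in> M i})"
    (is "irreducible_algebraic_set ?S")
proof (rule irreducible_algebraic_setI)
  have M: "vec.subspace (M i)" for i using irr unfolding vec.irreducible_tuple_def by blast
  show "algebraic_set ?S" by (rule det_row_space_algebraic[OF M])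
  have "kernel_param 0 0 0 \<in> ?S" by (rule kernel_param_in[OF M]) (simp_all add: M vec.subspace_0)
  then show "?S \<noteq> {}" by blast
  have dense: "\<forall>A\<in>?S. h A = 0"
    if "matrix_polynomial_function h"
      "\<And>x l w. (\<And>i. l $ i \<in> M i) \<Longrightarrow> (\<And>i. w $ i \<in> M i) \<Longrightarrow> h (kernel_param x l w) = 0" for h
    using kernel_param_dense[OF inf irr that] by (auto simp: det_hypersurface_def det_eq_0_iff_kernel)
  fix f g :: "'k ^ 'n ^ 'n \<Rightarrow> 'k"
  assume f: "matrix_polynomial_function f" and g: "matrix_polynomial_function g"
    and fg: "\<And>A. A \<in> ?S \<Longrightarrow> f A * g A = 0"
  have fg': "f (kernel_param x l w) * g (kernel_param x l w) = 0"
    if "\<And>i. l $ i \<in> M i" "\<And>i. w $ i \<in> M i" for x and l w :: "'k ^ 'n ^ 'n"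
    by (rule fg[OF kernel_param_in[OF M that]])
  show "(\<forall>A\<in>?S. f A = 0) \<or> (\<forall>A\<in>?S. g A = 0)"
  proof (cases "\<exists>x l w. (\<forall>i. l $ i \<in> M i) \<and> (\<forall>i. w $ i \<in> M i) \<and> f (kernel_param x l w) \<noteq> 0")
    case True
    then obtain x and l w :: "'k ^ 'n ^ 'n" where "\<And>i. l $ i \<in> M i" "\<And>i. w $ i \<in> M i" "f (kernel_param x l w) \<noteq> 0"
      by blast
    from dense[OF g kernel_param_prime[OF inf M f g fg' this]] show ?thesis by (rule disjI2)
  next
    case False
    then have "\<forall>A\<in>?S. f A = 0" by (intro dense[OF f]) blast
    then show ?thesis by blast
  qed
qed

section \<open>Transfer to coordinates\<close>

definition (in vector_space) coordinates :: "('n::finite \<Rightarrow> 'b) \<Rightarrow> 'b \<Rightarrow> 'a ^ 'n" where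
  "coordinates b v = (\<chi> j. representation (range b) v (b j))"

lemma (in vector_space) linear_coordinates:
  assumes "indexed_basis b"
  shows "Vector_Spaces.linear scale vector_scalar_mult (coordinates b)"
  unfolding Vector_Spaces.linear_iff
proof (intro conjI allI)
  have b: "independent (range b)" "\<And>v. v \<in> span (range b)"
    using assms by (auto simp: indexed_basis_def)
  show "vector_space scale" "vector_space vector_scalar_mult" by unfold_locales
  show "coordinates b (x + y) = coordinates b x + coordinates b y" for x y
    by (simp add: coordinates_def vec_eq_iff representation_add b)
  show "coordinates b (scale c x) = vector_scalar_mult c (coordinates b x)" for c x
    by (simp add: coordinates_def vec_eq_iff representation_scale b)
qed

text \<open>Expansion in the basis recovers a vector from its coordinates, giving injectivity; basis
  vectors go to unit vectors, giving surjectivity by linearity.\<close>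

lemma (in vector_space) bij_coordinates:
  assumes "indexed_basis b"
  shows "bij (coordinates b)"
proof (rule bijI)
  have b: "inj b" "independent (range b)" "span (range b) = UNIV"
    using assms by (auto simp: indexed_basis_def)
  have expand: "(\<Sum>j\<in>UNIV. scale (coordinates b v $ j) (b j)) = v" for v
    using sum_representation_eq[OF b(2), of v "range b"] b
    by (simp add: coordinates_def sum.reindex)
  then show "inj (coordinates b)" by (metis injI)
  interpret c: Vector_Spaces.linear scale vector_scalar_mult "coordinates b"
    by (rule linear_coordinates[OF assms])
  have "coordinates b (b j) = axis j 1" for j
    using b by (auto simp: coordinates_def vec_eq_iff axis_def representation_basis inj_eq)
  then have "coordinates b (\<Sum>j\<in>UNIV. scale (y $ j) (b j)) = y" for y
    by (simp add: c.sum c.scale basis_expansion)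
  then show "surj (coordinates b)" by (rule surjI)
qed

text \<open>The coordinate map acts on each row separately, so preimages of the rows can be chosen
  independently.\<close>

lemma (in vector_space) row_matrix_Pi_image:
  assumes "indexed_basis b"
  shows "row_matrix b ` Pi UNIV L = {A. \<forall>i. A $ i \<in> coordinates b ` L i}"
proof -
  have row: "row_matrix b v = (\<chi> i. coordinates b (v i))" for v
    by (simp add: row_matrix_def coordinates_def vec_eq_iff)
  have "A \<in> row_matrix b ` Pi UNIV L" if "\<forall>i. A $ i \<in> coordinates b ` L i" for A
  proof -
    define v where "v i = inv_into (L i) (coordinates b) (A $ i)" for i
    have "v i \<in> L i" "A $ i = coordinates b (v i)" for i
      using that by (simp_all add: v_def inv_into_into f_inv_into_f)
    then show ?thesis by (intro image_eqI[of _ _ v]) (auto simp: row vec_eq_iff)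
  qed
  moreover have "row_matrix b v $ i \<in> coordinates b ` L i" if "v \<in> Pi UNIV L" for v i
    using that by (simp add: row Pi_iff)
  ultimately show ?thesis by blast
qed

theorem theorem1p1:
  fixes scale :: "'k::alg_closed_field \<Rightarrow> 'v::ab_group_add \<Rightarrow> 'v"
    and b :: "'n::finite \<Rightarrow> 'v"
    and L :: "'n \<Rightarrow> 'v set"
  assumes "vector_space scale"
    and "vector_space.dim scale (UNIV :: 'v set) = CARD('n)"
    and "vector_space.indexed_basis scale b"
    and "vector_space.irreducible_tuple scale L"
  shows "irreducible_algebraic_set
           (det_hypersurface \<inter> vector_space.row_matrix scale b ` Pi UNIV L)"
proof -
  interpret vector_space scale by fact
  have "vec.irreducible_tuple (\<lambda>i. coordinates b ` L i)"
    by (rule irreducible_tuple_linear_image[OF linear_coordinates bij_coordinates]) (fact assms)+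
  from det_row_space_irreducible[OF infinite_UNIV_alg_closed_field this] show ?thesis
    by (simp only: row_matrix_Pi_image[OF assms(3)])
qed

end
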